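(* The Hilbert cube $Q=\prod_{i=1}^\infty [-1,1]$ is homogeneous, i.e. for any two points $p,q\in Q$ there is a homeomorphism of $Q$ onto itself mapping $p$ to $q$. Moreover, for points $p,q\in Q$, a homeomorphism that is the composition of maps of type (A) and of type (B), as defined in the context, can be defined to realize a self-homeomorphism of $Q$ mapping $p$ to $q$.
   Context: Let $I_i=[-1,1]$ for every integer $i\ge 1$. The Hilbert cube is $Q=\prod_{i=1}^\infty I_i$ with the product topology; points are written $p=(p_i)$. It is metrized by $d(p,q)=\sum_{i=1}^\infty |p_i-q_i|/2^i$. The pseudo-interior is $Q^o=\prod_{i=1}^\infty(-1,1)$ and the pseudo-boundary is $B(Q)=Q\setminus Q^o$. For maps $f,g:Q\to Q$ let $\rho(f,g)=\sup\{d(f(x),g(x)) \mid x\in Q\}$. Type (A). A map $f:Q\to Q$ is of type (A) if there are points $a=(a_i),b=(b_i)\in Q^o$ such that $f(x)=(f_i(x_i))$ for all $x=(x_i)\in Q$, where $f_i:I_i\to I_i$ is given by $$f_i(t)=(t+1)\frac{b_i+1}{a_i+1}-1 \ \text{ if } -1\le t\le a_i,\qquad f_i(t)=(t-a_i)\frac{1-b_i}{1-a_i}+b_i\ \text{ if } a_i<t\le 1.$$ The twist maps. Let $\epsilon_j=1/2^j$. For integers $m>n>0$ define $\overline{\phi_n^m}:I_n\times I_m\to I_n\times I_m$ as follows. For $(x,y)\in I_n\times I_m$ put $\sigma=1$ if $x\ge 0$ and $\sigma=-1$ if $x<0$, and set $$\overline{\phi_n^m}(x,y)=\begin{cases}\left(\sigma-\frac{\epsilon_m}{\epsilon_n}(y+\sigma),\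 y+\sigma+\frac{\epsilon_n}{\epsilon_m}(x-\sigma)\right) & \text{Type I},\\[2pt] \left(x,\ y+\sigma+\frac{\epsilon_n}{\epsilon_m}(x-\sigma)\right) & \text{Type II},\\[2pt] \left(x-\frac{\epsilon_m}{\epsilon_n}y,\ \sigma+\frac{\epsilon_n}{\epsilon_m}(x-\sigma)\right) & \text{Type III},\\[2pt] \left(x-\frac{\epsilon_m}{\epsilon_n}y,\ y\right) & \text{Type IV},\end{cases}$$ where the types are: Type I: $xy\le 0$, $1-\frac{\epsilon_m}{\epsilon_n}\le|x|\le 1$ and $\frac{\epsilon_n}{\epsilon_m}(|x|-1)+1\le|y|\le 1$; Type II: $xy\le 0$, $1-\frac{\epsilon_m}{\epsilon_n}\le|x|\le 1$ and $0\le|y|\le\frac{\epsilon_n}{\epsilon_m}(|x|-1)+1$; Type III: $xy\ge 0$, $1-\frac{\epsilon_m}{\epsilon_n}\le|x|\le 1$ and $0\le|y|\le\frac{\epsilon_n}{\epsilon_m}(|x|-1)+1$; Type IV: either $xy\ge 0$, $1-\frac{\epsilon_m}{\epsilon_n}\le|x|\le 1$ and $\frac{\epsilon_n}{\epsilon_m}(|x|-1)+1\le|y|\le 1$; or $|x|\le 1-\frac{\epsilon_m}{\epsilon_n}$. Let $\phi_n^m:Q\to Q$ be the map acting as $\overline{\phi_n^m}$ on the coordinates $(x_n,x_m)$ and as the identity on all other coordinates, and let $\Phi_n^m=(\phi_n^m)^3=\phi_n^m\circ\phi_n^m\circ\phi_n^m$. Type (B). A map $h:Q\to Q$ is of type (B)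 if it is a homeomorphism of $Q$ onto itself and there is a point $r=(r_i)\in B(Q)$, with set of boundary indices $J=\{j \mid r_j\in\{-1,1\}\}$, and sequences $(n_k)_{k\ge1}$, $(m_k)_{k\ge1}$ of positive integers such that: $n_1=\min J$; $m_1\in\{4i\mid i\ge1\}$ with $m_1>n_1$; for each $k\ge2$, $n_k=\min\big((\{m_1,\dots,m_{k-1}\}\cup J)\setminus\{n_1,\dots,n_{k-1}\}\big)$ and $m_k\in\{4i\mid i\ge 1\}$ with $m_k>m_{k-1}$ and $m_k>n_k$; and $$h=\lim_{i\to\infty}\Phi_{n_i}^{m_i}\Phi_{n_{i-1}}^{m_{i-1}}\cdots\Phi_{n_1}^{m_1},$$ the limit being taken with respect to $\rho$.
   Formalization: Inverses of type (B) maps are also allowed as factors, since maps of types (A) and (B) send the pseudo-interior into itself and cannot carry an interior p to a boundary q; for q in the pseudo-interior the claim is proved without inverses. *)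

theory Defs
  imports "HOL-Analysis.Analysis"
begin

text \<open>Points of \<open>Q\<close> are functions on the index set \<open>{1..}\<close>, extended by \<open>undefined\<close> at index \<open>0\<close>.\<close>

definition hilbert_cube :: "(nat \<Rightarrow> real) topology" where
  "hilbert_cube = product_topology (\<lambda>i. top_of_set {-1..1}) {1..}"

abbreviation Q :: "(nat \<Rightarrow> real) set" where
  "Q \<equiv> topspace hilbert_cube"

definition pseudo_interior :: "(nat \<Rightarrow> real) set" where
  "pseudo_interior = (\<Pi>\<^sub>E i\<in>{1..}. {-1<..<1})"

definition pseudo_boundary :: "(nat \<Rightarrow> real) set" where
  "pseudo_boundary = Q - pseudo_interior"

definition cube_dist :: "(nat \<Rightarrow> real) \<Rightarrow> (nat \<Rightarrow> real) \<Rightarrow> real" where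
  "cube_dist p q = (\<Sum>i. \<bar>p (Suc i) - q (Suc i)\<bar> / 2 ^ Suc i)"

definition map_dist ::
    "((nat \<Rightarrow> real) \<Rightarrow> nat \<Rightarrow> real) \<Rightarrow> ((nat \<Rightarrow> real) \<Rightarrow> nat \<Rightarrow> real) \<Rightarrow> real" where
  "map_dist f g = (SUP x\<in>Q. cube_dist (f x) (g x))"

definition homogeneous_space :: "'a topology \<Rightarrow> bool" where
  "homogeneous_space X \<longleftrightarrow>
     (\<forall>p\<in>topspace X. \<forall>q\<in>topspace X. \<exists>h. homeomorphic_map X X h \<and> h p = q)"

definition pl_map :: "real \<Rightarrow> real \<Rightarrow> real \<Rightarrow> real" where
  "pl_map a b t =
     (if t \<le> a then (t + 1) * ((b + 1) / (a + 1)) - 1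
      else (t - a) * ((1 - b) / (1 - a)) + b)"

definition type_A :: "((nat \<Rightarrow> real) \<Rightarrow> nat \<Rightarrow> real) \<Rightarrow> bool" where
  "type_A f \<longleftrightarrow> (\<exists>a\<in>pseudo_interior. \<exists>b\<in>pseudo_interior.
     \<forall>x\<in>Q. f x = (\<lambda>i\<in>{1..}. pl_map (a i) (b i) (x i)))"

definition eps :: "nat \<Rightarrow> real" where
  "eps j = 1 / 2 ^ j"

definition twist_I :: "nat \<Rightarrow> nat \<Rightarrow> real \<Rightarrow> real \<Rightarrow> bool" where
  "twist_I n m x y \<longleftrightarrow> x * y \<le> 0 \<and> 1 - eps m / eps n \<le> \<bar>x\<bar> \<and> \<bar>x\<bar> \<le> 1 \<and>
     eps n / eps m * (\<bar>x\<bar> - 1) + 1 \<le> \<bar>y\<bar> \<and> \<bar>y\<bar> \<le> 1"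

definition twist_II :: "nat \<Rightarrow> nat \<Rightarrow> real \<Rightarrow> real \<Rightarrow> bool" where
  "twist_II n m x y \<longleftrightarrow> x * y \<le> 0 \<and> 1 - eps m / eps n \<le> \<bar>x\<bar> \<and> \<bar>x\<bar> \<le> 1 \<and>
     0 \<le> \<bar>y\<bar> \<and> \<bar>y\<bar> \<le> eps n / eps m * (\<bar>x\<bar> - 1) + 1"

definition twist_III :: "nat \<Rightarrow> nat \<Rightarrow> real \<Rightarrow> real \<Rightarrow> bool" where
  "twist_III n m x y \<longleftrightarrow> x * y \<ge> 0 \<and> 1 - eps m / eps n \<le> \<bar>x\<bar> \<and> \<bar>x\<bar> \<le> 1 \<and>
     0 \<le> \<bar>y\<bar> \<and> \<bar>y\<bar> \<le> eps n / eps m * (\<bar>x\<bar> - 1) + 1"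

definition twist_IV :: "nat \<Rightarrow> nat \<Rightarrow> real \<Rightarrow> real \<Rightarrow> bool" where
  "twist_IV n m x y \<longleftrightarrow>
     (x * y \<ge> 0 \<and> 1 - eps m / eps n \<le> \<bar>x\<bar> \<and> \<bar>x\<bar> \<le> 1 \<and>
      eps n / eps m * (\<bar>x\<bar> - 1) + 1 \<le> \<bar>y\<bar> \<and> \<bar>y\<bar> \<le> 1) \<or>
     \<bar>x\<bar> \<le> 1 - eps m / eps n"

definition twist_sign :: "real \<Rightarrow> real" where
  "twist_sign x = (if x \<ge> 0 then 1 else -1)"

text \<open>The four types cover the square \<open>[-1,1] \<times> [-1,1]\<close> and overlap only where the
  formulas agree, see \<open>twist_types\<close> and \<open>twist_eqs\<close>. So the order of the cases is immaterial.\<close>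

definition twist :: "nat \<Rightarrow> nat \<Rightarrow> real \<Rightarrow> real \<Rightarrow> real \<times> real" where
  "twist n m x y = (let s = twist_sign x in
     if twist_I n m x y then
       (s - eps m / eps n * (y + s), y + s + eps n / eps m * (x - s))
     else if twist_II n m x y then
       (x, y + s + eps n / eps m * (x - s))
     else if twist_III n m x y then
       (x - eps m / eps n * y, s + eps n / eps m * (x - s))
     else
       (x - eps m / eps n * y, y))"

lemma twist_types:
  assumes "\<bar>x\<bar> \<le> 1" "\<bar>y\<bar> \<le> 1"
  shows "twist_I n m x y \<or> twist_II n m x y \<or> twist_III n m x y \<or> twist_IV n m x y"
  using assms unfolding twist_I_def twist_II_def twist_III_def twist_IV_def by linarith

lemma twist_eqs:
  fixes x y :: real
  assumes "0 < n" "n < m" "\<bar>x\<bar> \<le> 1" "\<bar>y\<bar> \<le> 1"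
  defines "s \<equiv> twist_sign x"
  shows "twist_I n m x y \<Longrightarrow>
      twist n m x y = (s - eps m / eps n * (y + s), y + s + eps n / eps m * (x - s))"
    and "twist_II n m x y \<Longrightarrow> twist n m x y = (x, y + s + eps n / eps m * (x - s))"
    and "twist_III n m x y \<Longrightarrow>
      twist n m x y = (x - eps m / eps n * y, s + eps n / eps m * (x - s))"
    and "twist_IV n m x y \<Longrightarrow> twist n m x y = (x - eps m / eps n * y, y)"
proof -
  define k where "k = eps m / eps n"
  define K where "K = eps n / eps m"
  have Kk: "K * k = 1" "k > 0" "K > 0" by (simp_all add: k_def K_def eps_def)
  have "(2::real) ^ n * 2 \<le> 2 ^ m"
    using power_increasing[of "Suc n" m "2::real"] assms(2) by simp
  then have k2: "k \<le> 1/2" by (simp add: k_def eps_def field_simps)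
  have inv: "u = k * v \<longleftrightarrow> v = K * u" for u v
    using Kk by (metis mult.assoc mult.commute mult_1)
  have eqI: "K * u + 1 = v \<Longrightarrow> u = k * (v - 1)" for u v
    by (simp add: inv)
  have I_II: "s - k * (y + s) = x" if "twist_I n m x y" "twist_II n m x y"
  proof -
    have e: "K * (\<bar>x\<bar> - 1) + 1 = \<bar>y\<bar>" and xy: "x * y \<le> 0" and "1 - k \<le> \<bar>x\<bar>"
      using that by (auto simp: twist_I_def twist_II_def K_def k_def)
    from eqI[OF e] have e': "\<bar>x\<bar> - 1 = k * (\<bar>y\<bar> - 1)" .
    show ?thesis
    proof (cases "x \<ge> 0")
      case True
      then have "x > 0" using \<open>1 - k \<le> \<bar>x\<bar>\<close> k2 by linarith
      then have "y \<le> 0" using xy by (simp add: mult_le_0_iff)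
      then show ?thesis using e' True by (simp add: s_def twist_sign_def algebra_simps)
    next
      case False
      then have "y \<ge> 0" using xy by (simp add: mult_le_0_iff)
      then show ?thesis using e' False by (simp add: s_def twist_sign_def algebra_simps)
    qed
  qed
  have edge: "K * (x - s) = - s" if "\<bar>x\<bar> = 1 - k"
  proof -
    have "x - s = k * (- s)"
      using that by (auto simp: s_def twist_sign_def abs_if split: if_splits)
    then show ?thesis using Kk(1) by (simp add: inv)
  qed
  have y0: "y = 0" if "x * y \<le> 0" "x * y \<ge> 0" "1 - k \<le> \<bar>x\<bar>"
  proof -
    have "x * y = 0" using that by linarith
    moreover have "x \<noteq> 0" using that k2 by auto
    ultimately show ?thesis by simp
  qed
  have sabs: "s * (K * (\<bar>x\<bar> - 1) + 1) = s + K * (x - s)"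
    by (auto simp: s_def twist_sign_def algebra_simps)
  have y_III: "y = s * \<bar>y\<bar>" if "x * y \<ge> 0" "1 - k \<le> \<bar>x\<bar>"
    using that k2 by (auto simp: s_def twist_sign_def zero_le_mult_iff abs_if)
  have ceq: "K * (\<bar>x\<bar> - 1) + 1 \<ge> 0" if "1 - k \<le> \<bar>x\<bar>"
  proof -
    have "K * (- k) \<le> K * (\<bar>x\<bar> - 1)" using that Kk by (intro mult_left_mono) auto
    then show ?thesis using Kk by simp
  qed
  have c0: "\<bar>x\<bar> = 1 - k" if "K * (\<bar>x\<bar> - 1) + 1 = 0"
    using eqI[OF that] by simp
  show I: "twist n m x y = (s - eps m / eps n * (y + s), y + s + eps n / eps m * (x - s))"
    if "twist_I n m x y"
    using that by (simp add: twist_def s_def Let_def)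
  show II: "twist n m x y = (x, y + s + eps n / eps m * (x - s))" if "twist_II n m x y"
    using that I I_II by (cases "twist_I n m x y")
      (simp_all add: twist_def s_def Let_def k_def K_def)
  show III: "twist n m x y = (x - eps m / eps n * y, s + eps n / eps m * (x - s))"
    if t: "twist_III n m x y"
  proof (cases "twist_I n m x y \<or> twist_II n m x y")
    case True
    then have y: "y = 0" using t y0 by (auto simp: twist_I_def twist_II_def twist_III_def k_def)
    then have "twist_II n m x y" using t by (simp add: twist_II_def twist_III_def)
    from II[OF this] y show ?thesis by simp
  qed (use t in \<open>simp add: twist_def s_def Let_def\<close>)
  show "twist n m x y = (x - eps m / eps n * y, y)" if t: "twist_IV n m x y"
  proof (cases "\<bar>x\<bar> \<le> 1 - k")
    case True
    show ?thesis
    proof (cases "twist_I n m x y \<or> twist_II n m x y \<or> twist_III n m x y")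
      case any: True
      then have xk: "\<bar>x\<bar> = 1 - k"
        using True by (auto simp: twist_I_def twist_II_def twist_III_def k_def)
      then have E: "K * (x - s) = - s" by (rule edge)
      have c: "K * (\<bar>x\<bar> - 1) + 1 = 0" using xk Kk(1) by simp
      have xs: "k * s = s - x" using E inv[of "x - s" "- s"] by simp
      show ?thesis
      proof (cases "twist_I n m x y")
        case True
        have "s - k * (y + s) = x - k * y" using xs by (simp add: distrib_left)
        then show ?thesis using I[OF True] E by (simp add: k_def K_def)
      next
        case False
        then have "y = 0" using any c by (auto simp: twist_II_def twist_III_def K_def)
        then show ?thesis using any False II III E by (auto simp: K_def)
      qed
    qed (simp add: twist_def Let_def)
  next
    case False
    then have h: "x * y \<ge> 0" "1 - k \<le> \<bar>x\<bar>" "K * (\<bar>x\<bar> - 1) + 1 \<le> \<bar>y\<bar>"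
      using t by (auto simp: twist_IV_def k_def K_def)
    have c: "K * (\<bar>x\<bar> - 1) + 1 > 0" using ceq[OF h(2)] c0 False by fastforce
    have n12: "\<not> twist_I n m x y" "\<not> twist_II n m x y"
      using h c y0 by (auto simp: twist_I_def twist_II_def k_def K_def)
    show ?thesis
    proof (cases "twist_III n m x y")
      case True
      then have "\<bar>y\<bar> = K * (\<bar>x\<bar> - 1) + 1" using h by (auto simp: twist_III_def K_def)
      then have "y = s + K * (x - s)" using y_III[OF h(1,2)] sabs by metis
      then show ?thesis using III[OF True] by (simp add: K_def)
    qed (use n12 in \<open>simp add: twist_def Let_def\<close>)
  qed
qed

definition cube_twist :: "nat \<Rightarrow> nat \<Rightarrow> (nat \<Rightarrow> real) \<Rightarrow> nat \<Rightarrow> real" where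
  "cube_twist n m x = x(n := fst (twist n m (x n) (x m)), m := snd (twist n m (x n) (x m)))"

definition cube_twist3 :: "nat \<Rightarrow> nat \<Rightarrow> (nat \<Rightarrow> real) \<Rightarrow> nat \<Rightarrow> real" where
  "cube_twist3 n m = cube_twist n m \<circ> cube_twist n m \<circ> cube_twist n m"

primrec twist_comp ::
    "(nat \<Rightarrow> nat) \<Rightarrow> (nat \<Rightarrow> nat) \<Rightarrow> nat \<Rightarrow> (nat \<Rightarrow> real) \<Rightarrow> nat \<Rightarrow> real" where
  "twist_comp n m 0 = id"
| "twist_comp n m (Suc i) = cube_twist3 (n (Suc i)) (m (Suc i)) \<circ> twist_comp n m i"

definition boundary_indices :: "(nat \<Rightarrow> real) \<Rightarrow> nat set" where
  "boundary_indices r = {j. j \<ge> 1 \<and> r j \<in> {-1, 1}}"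

text \<open>The sequences are indexed from \<open>1\<close>; their values at \<open>0\<close> are irrelevant. The sets whose
  least element is taken below are never empty.\<close>

definition twist_sequences :: "nat set \<Rightarrow> (nat \<Rightarrow> nat) \<Rightarrow> (nat \<Rightarrow> nat) \<Rightarrow> bool" where
  "twist_sequences J n m \<longleftrightarrow>
     (\<forall>k\<ge>1. n k > 0 \<and> m k > 0) \<and>
     n 1 = (LEAST j. j \<in> J) \<and>
     m 1 \<in> {4 * i |i. i \<ge> 1} \<and> m 1 > n 1 \<and>
     (\<forall>k\<ge>2.
        n k = (LEAST j. j \<in> (m ` {1..<k} \<union> J) - n ` {1..<k}) \<and>
        m k \<in> {4 * i |i. i \<ge> 1} \<and> m k > m (k - 1) \<and> m k > n k)"

definition type_B :: "((nat \<Rightarrow> real) \<Rightarrow> nat \<Rightarrow> real) \<Rightarrow> bool" where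
  "type_B h \<longleftrightarrow> homeomorphic_map hilbert_cube hilbert_cube h \<and>
     (\<exists>r\<in>pseudo_boundary. \<exists>n m. twist_sequences (boundary_indices r) n m \<and>
        (\<lambda>i. map_dist (twist_comp n m i) h) \<longlonglongrightarrow> 0)"

inductive AB_composition :: "((nat \<Rightarrow> real) \<Rightarrow> nat \<Rightarrow> real) \<Rightarrow> bool" where
  "type_A f \<Longrightarrow> AB_composition f"
| "type_B f \<Longrightarrow> AB_composition f"
| "AB_composition f \<Longrightarrow> AB_composition g \<Longrightarrow> AB_composition (g \<circ> f)"

text \<open>All maps of type (A) and (B) map the pseudo-interior into itself, so a point of the
  pseudo-boundary can be reached from the pseudo-interior only if inverses are allowed as factors.
  Inverses of maps of type (A) are again of type (A), so only type (B) needs them.\<close>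

inductive AB_inv_composition :: "((nat \<Rightarrow> real) \<Rightarrow> nat \<Rightarrow> real) \<Rightarrow> bool" where
  "type_A f \<Longrightarrow> AB_inv_composition f"
| "type_B f \<Longrightarrow> AB_inv_composition f"
| "type_B f \<Longrightarrow> homeomorphic_maps hilbert_cube hilbert_cube f g \<Longrightarrow> AB_inv_composition g"
| "AB_inv_composition f \<Longrightarrow> AB_inv_composition g \<Longrightarrow> AB_inv_composition (g \<circ> f)"

end

(* The twist of a rectangle is a piecewise linear rotation; after rescaling the x-side it is given by
   one formula in max and min, and reflecting y turns it into an involution. So it is a
   bi-Lipschitz homeomorphism, and its cube carries the edges |x| = 1 into the edges |y| = 1, away
   from the corners. Hence Phi_n^m moves the boundary coordinate n of a point into the open interval at
   the price of a boundary coordinate m. Treating the pending boundary coordinates in increasing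
   order leaves coordinate j unchanged after stage j, so the infinite composition converges, and no
   coordinate of the limit is on the boundary. With m_k growing fast enough the k-th displacement
   is of order 2^-m_k, which beats the Lipschitz constant 4096^k of the inverse of stage k; this makes
   the limit injective. It is onto because its image is compact and dense. *)
theory Submission
  imports Defs
begin

section \<open>The twist of a single rectangle\<close>

text \<open>\<open>rot\<close> is the twist in the coordinates \<open>X = K x\<close>, \<open>Y = y\<close> with \<open>K = eps n / eps m\<close>, in which all
  its pieces have integer coefficients. \<open>P\<close> and \<open>N\<close> measure how far \<open>X\<close> enters the end zones
  \<open>K - 1 \<le> X\<close> and \<open>X \<le> 1 - K\<close>; for \<open>K \<ge> 2\<close> one of them vanishes.\<close>

definition rot_x :: "real \<Rightarrow> real \<Rightarrow> real \<Rightarrow> real" where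
  "rot_x K X Y = (let P = max 0 (X - (K - 1)); N = max 0 (- X - (K - 1)) in
     X - P + N + max (P - max 0 Y) (- Y) - max (N - max 0 (- Y)) Y + Y)"

definition rot_y :: "real \<Rightarrow> real \<Rightarrow> real \<Rightarrow> real" where
  "rot_y K X Y = (let P = max 0 (X - (K - 1)); N = max 0 (- X - (K - 1)) in
     max Y (min P (Y + P)) + min Y (max (- N) (Y - N)) - Y)"

text \<open>The point reflection exchanges \<open>P\<close> and \<open>N\<close>. It lets the later
  case analyses treat only the half with \<open>X\<close> nonnegative.\<close>

lemma rot_minus:
  "rot_x K (- X) (- Y) = - rot_x K X Y" "rot_y K (- X) (- Y) = - rot_y K X Y"
  unfolding rot_x_def rot_y_def Let_def by (simp_all add: min_def max_def)

text \<open>For \<open>K \<ge> 2\<close> the left end zone lies in \<open>X \<le> -1\<close>, so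
  \<open>N\<close> vanishes. The range starts at -1 rather than 0 because one rotation can move a
  point of the right half left by as much as 1, and the formula has to apply to the image as
  well.\<close>

lemma rot_right:
  assumes "K \<ge> 2" "X \<ge> -1" "\<bar>Y\<bar> \<le> 1"
  shows "rot_x K X Y = (if X \<le> K - 1 \<or> Y \<ge> 0 then X - Y
           else if - Y \<le> X - (K - 1) then X else K - 1 - Y)"
    and "rot_y K X Y = (if X \<le> K - 1 \<or> X - (K - 1) \<le> Y then Y
           else if Y \<ge> 0 then X - (K - 1) else Y + X - (K - 1))"
proof -
  have N: "max 0 (- X - (K - 1)) = 0" using assms by simp
  show "rot_x K X Y = (if X \<le> K - 1 \<or> Y \<ge> 0 then X - Y
           else if - Y \<le> X - (K - 1) then X else K - 1 - Y)"
    unfolding rot_x_def Let_def N by (simp add: max_def)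
  show "rot_y K X Y = (if X \<le> K - 1 \<or> X - (K - 1) \<le> Y then Y
           else if Y \<ge> 0 then X - (K - 1) else Y + X - (K - 1))"
    unfolding rot_y_def Let_def N by (simp add: max_def min_def)
qed

lemma reflect_rot_right:
  assumes "K \<ge> 2" "0 \<le> X" "X \<le> K" "\<bar>Y\<bar> \<le> 1"
  shows "\<bar>rot_x K X Y\<bar> \<le> K \<and> \<bar>rot_y K X Y\<bar> \<le> 1 \<and>
    rot_x K (rot_x K X Y) (- rot_y K X Y) = X \<and> rot_y K (rot_x K X Y) (- rot_y K X Y) = - Y"
proof -
  have X: "X \<ge> -1" using assms by simp
  have *: "- 1 \<le> rot_x K X Y" "rot_x K X Y \<le> K" "\<bar>- rot_y K X Y\<bar> \<le> 1"
    unfolding rot_right[OF assms(1) X assms(4)] using assms by (auto split: if_splits)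
  show ?thesis
    unfolding rot_right[OF assms(1) *(1,3)]
    using * unfolding rot_right[OF assms(1) X assms(4)] using assms
    by (auto split: if_splits)
qed

lemma reflect_rot_involution:
  assumes "K \<ge> 2" "\<bar>X\<bar> \<le> K" "\<bar>Y\<bar> \<le> 1"
  shows "\<bar>rot_x K X Y\<bar> \<le> K" "\<bar>rot_y K X Y\<bar> \<le> 1"
    "rot_x K (rot_x K X Y) (- rot_y K X Y) = X"
    "rot_y K (rot_x K X Y) (- rot_y K X Y) = - Y"
proof -
  have "\<bar>rot_x K X Y\<bar> \<le> K \<and> \<bar>rot_y K X Y\<bar> \<le> 1 \<and>
    rot_x K (rot_x K X Y) (- rot_y K X Y) = X \<and> rot_y K (rot_x K X Y) (- rot_y K X Y) = - Y"
  proof (cases "X \<ge> 0")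
    case True
    then show ?thesis using reflect_rot_right[of K X Y] assms by simp
  next
    case False
    then show ?thesis using reflect_rot_right[of K "- X" "- Y"] assms
        rot_minus[of K X Y] rot_minus[of K "rot_x K X Y" "- rot_y K X Y"] by simp
  qed
  then show "\<bar>rot_x K X Y\<bar> \<le> K" "\<bar>rot_y K X Y\<bar> \<le> 1"
    "rot_x K (rot_x K X Y) (- rot_y K X Y) = X"
    "rot_y K (rot_x K X Y) (- rot_y K X Y) = - Y" by blast+
qed

lemma rot_displacement:
  assumes "K \<ge> 2" "\<bar>X\<bar> \<le> K" "\<bar>Y\<bar> \<le> 1"
  shows "\<bar>rot_x K X Y - X\<bar> \<le> 1" "\<bar>rot_y K X Y - Y\<bar> \<le> 1"
proof -
  have right: "\<bar>rot_x K X Y - X\<bar> \<le> 1 \<and> \<bar>rot_y K X Y - Y\<bar> \<le> 1"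
    if "X \<ge> 0" "X \<le> K" "\<bar>Y\<bar> \<le> 1" for X Y
    using that assms(1) rot_right[of K X Y] by auto
  have "\<bar>rot_x K X Y - X\<bar> \<le> 1 \<and> \<bar>rot_y K X Y - Y\<bar> \<le> 1"
    using right[of X Y] right[of "- X" "- Y"] assms rot_minus[of K X Y]
    by (cases "X \<ge> 0") (simp_all add: abs_minus_commute)
  then show "\<bar>rot_x K X Y - X\<bar> \<le> 1" "\<bar>rot_y K X Y - Y\<bar> \<le> 1" by blast+
qed

text \<open>All four rules have the same crude bound \<open>r + s\<close>, even for
  \<open>max\<close> and \<open>min\<close>, so that a Lipschitz estimate can be read off the syntax
  tree of an expression.\<close>

lemma abs_diff_combine_le:
  fixes a b c d :: real
  assumes "\<bar>a - c\<bar> \<le> r" "\<bar>b - d\<bar> \<le> s"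
  shows "\<bar>(a + b) - (c + d)\<bar> \<le> r + s" "\<bar>(a - b) - (c - d)\<bar> \<le> r + s"
    "\<bar>max a b - max c d\<bar> \<le> r + s" "\<bar>min a b - min c d\<bar> \<le> r + s"
  using assms by (auto simp: max_def min_def)

lemma abs_diff_minus_le: "\<bar>a - c\<bar> \<le> r \<Longrightarrow> \<bar>(- a) - (- c)\<bar> \<le> (r :: real)"
  by simp

text \<open>The formula in \<open>max\<close> and \<open>min\<close> avoids any comparison of points
  from different pieces. Counting occurrences gives the constants 10 and 9; they are rounded up to a
  power of two, so that three twists cost 4096 = 2^12.\<close>

lemma rot_Lipschitz:
  assumes "\<bar>X - X'\<bar> \<le> e" "\<bar>Y - Y'\<bar> \<le> e"
  shows "\<bar>rot_x K X Y - rot_x K X' Y'\<bar> \<le> 16 * e" "\<bar>rot_y K X Y - rot_y K X' Y'\<bar> \<le> 16 * e"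
proof -
  define P where "P = (\<lambda>X::real. max 0 (X - (K - 1)))"
  define M where "M = (\<lambda>Y::real. max 0 Y)"
  have P: "\<bar>P X - P X'\<bar> \<le> e" "\<bar>P (- X) - P (- X')\<bar> \<le> e"
    and M: "\<bar>M Y - M Y'\<bar> \<le> e" "\<bar>M (- Y) - M (- Y')\<bar> \<le> e"
    unfolding P_def M_def using assms by (auto simp: max_def)
  have rot: "rot_x K X Y = X - P X + P (- X) + max (P X - M Y) (- Y) - max (P (- X) - M (- Y)) Y + Y"
    "rot_y K X Y = max Y (min (P X) (Y + P X)) + min Y (max (- P (- X)) (Y - P (- X))) - Y" for X Y
    by (simp_all add: rot_x_def rot_y_def Let_def P_def M_def)
  have e: "e \<ge> 0" using assms by linarith
  have "\<bar>rot_x K X Y - rot_x K X' Y'\<bar> \<le> e + e + e + (e + e + e) + (e + e + e) + e"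
    unfolding rot by (intro abs_diff_combine_le abs_diff_minus_le assms P M)
  then show "\<bar>rot_x K X Y - rot_x K X' Y'\<bar> \<le> 16 * e" using e by simp
  have "\<bar>rot_y K X Y - rot_y K X' Y'\<bar> \<le> e + (e + (e + e)) + (e + (e + (e + e))) + e"
    unfolding rot by (intro abs_diff_combine_le abs_diff_minus_le assms P)
  then show "\<bar>rot_y K X Y - rot_y K X' Y'\<bar> \<le> 16 * e" using e by simp
qed

text \<open>A point is recovered from its image by reflecting, rotating and reflecting again, so the
  inverse inherits the constant 16.\<close>

lemma rot_coLipschitz:
  assumes "K \<ge> 2" "\<bar>X\<bar> \<le> K" "\<bar>Y\<bar> \<le> 1" "\<bar>X'\<bar> \<le> K" "\<bar>Y'\<bar> \<le> 1"
    and "\<bar>rot_x K X Y - rot_x K X' Y'\<bar> \<le> e" "\<bar>rot_y K X Y - rot_y K X' Y'\<bar> \<le> e"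
  shows "\<bar>X - X'\<bar> \<le> 16 * e" "\<bar>Y - Y'\<bar> \<le> 16 * e"
  using rot_Lipschitz[of "rot_x K X Y" "rot_x K X' Y'" e "- rot_y K X Y" "- rot_y K X' Y'" K]
    assms reflect_rot_involution(3,4)[of K X Y] reflect_rot_involution(3,4)[of K X' Y']
  by (simp_all add: abs_minus_commute)

text \<open>For \<open>Y \<ge> 0\<close> the orbit of (K, Y) is (K - Y, 1), (K - 1 - Y, 1), (K - 2 -
  Y, 1); for \<open>Y < 0\<close> it starts with (K, Y + 1) and then continues in the same way. Two
  steps would leave the corner \<open>Y = -1\<close> on the edge \<open>X = K\<close>; the third
  brings every point to \<open>X \<le> K - 1\<close>.\<close>

lemma rot_cubed_edge:
  assumes "K \<ge> 2" "\<bar>Y\<bar> \<le> 1"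
  defines "a \<equiv> rot_x K K Y" and "b \<equiv> rot_y K K Y"
  defines "c \<equiv> rot_x K a b" and "d \<equiv> rot_y K a b"
  shows "rot_x K c d = K - 2 - Y" "rot_y K c d = 1"
proof -
  have a: "a = (if Y \<ge> 0 then K - Y else K)" and b: "b = (if Y \<ge> 0 then 1 else Y + 1)"
    unfolding a_def b_def using assms(1,2) by (subst rot_right; auto)+
  have c: "c = K - 1 - Y" and d: "d = 1"
    unfolding c_def d_def using assms(1,2) by (subst rot_right; auto simp: a b)+
  show "rot_x K c d = K - 2 - Y" "rot_y K c d = 1"
    using assms(1,2) by (subst rot_right; auto simp: c d)+
qed

lemma eps_ratio:
  assumes "n \<le> m"
  shows "eps n / eps m = 2 ^ (m - n)" "eps m / eps n = 1 / 2 ^ (m - n)"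
  using assms by (simp_all add: eps_def power_diff)

lemma twist_eq_rot:
  assumes "0 < n" "n < m" "\<bar>x\<bar> \<le> 1" "\<bar>y\<bar> \<le> 1"
  defines "K \<equiv> 2 ^ (m - n)"
  shows "twist n m x y = (rot_x K (K * x) y / K, rot_y K (K * x) y)"
proof -
  have K: "K \<ge> 2" using power_increasing[of 1 "m - n" "2::real"] assms(2) by (simp add: K_def)
  have e: "eps n / eps m = K" "eps m / eps n = 1 / K"
    using eps_ratio[of n m] assms(2) by (simp_all add: K_def)
  note tw = twist_eqs[OF assms(1-4), unfolded e] 
  define X where "X = K * x"
  have aX: "\<bar>X\<bar> = K * \<bar>x\<bar>" using K by (simp add: X_def abs_mult)
  have c1: "1 - 1 / K \<le> \<bar>x\<bar> \<longleftrightarrow> K - 1 \<le> \<bar>X\<bar>" "\<bar>x\<bar> \<le> 1 - 1 / K \<longleftrightarrow> \<bar>X\<bar> \<le> K - 1"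
    using K by (simp_all add: aX field_simps)
  have c2: "K * (\<bar>x\<bar> - 1) + 1 = \<bar>X\<bar> - (K - 1)" by (simp add: aX algebra_simps)
  have sx: "x * y \<le> 0 \<longleftrightarrow> X * y \<le> 0" "x * y \<ge> 0 \<longleftrightarrow> X * y \<ge> 0"
    using K by (simp_all add: X_def mult_le_0_iff zero_le_mult_iff)
  have s: "twist_sign x = twist_sign X" using K by (simp add: twist_sign_def X_def zero_le_mult_iff)
  have XK: "\<bar>X\<bar> \<le> K" using aX assms(3) K by (simp add: mult_left_le)
  let ?s = "twist_sign X"
  have div: "a = b / K \<longleftrightarrow> K * a = b" for a b using K by (auto simp: field_simps)
  have sgn_y: "(X > 0 \<longrightarrow> y \<le> 0) \<and> (X < 0 \<longrightarrow> y \<ge> 0)" if "X * y \<le> 0"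
    using that by (auto simp: mult_le_0_iff)
  have sgn_y': "(X > 0 \<longrightarrow> y \<ge> 0) \<and> (X < 0 \<longrightarrow> y \<le> 0)" if "X * y \<ge> 0"
    using that by (auto simp: zero_le_mult_iff)
  \<comment> \<open>The sign \<open>?s\<close> joins the two halves, related by
    \<open>rot_minus\<close>, into one formula that can be compared with the four types.\<close>
  have rot: "rot_x K X y = (if \<bar>X\<bar> \<le> K - 1 \<or> ?s * y \<ge> 0 then X - y
           else if \<bar>y\<bar> \<le> \<bar>X\<bar> - (K - 1) then X else ?s * (K - 1) - y)"
    "rot_y K X y = (if \<bar>X\<bar> \<le> K - 1 \<or> \<bar>X\<bar> - (K - 1) \<le> ?s * y then y
           else if ?s * y \<ge> 0 then X - ?s * (K - 1) else y + X - ?s * (K - 1))"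
    using K XK assms(4) rot_right[of K X y] rot_right[of K "- X" "- y"] rot_minus[of K X y]
    by (cases "X \<ge> 0"; auto simp: twist_sign_def)+
  consider "twist_I n m x y" | "twist_II n m x y" | "twist_III n m x y" | "twist_IV n m x y"
    using twist_types[OF assms(3,4)] by blast
  then show ?thesis
  proof cases
    case 1
    then have "X * y \<le> 0" "K - 1 \<le> \<bar>X\<bar>" "\<bar>X\<bar> - (K - 1) \<le> \<bar>y\<bar>"
      unfolding twist_I_def e c1 c2 sx by auto
    then have "rot_x K X y = K * ?s - (y + ?s) \<and> rot_y K X y = y + ?s + (X - K * ?s)"
      using sgn_y K unfolding rot by (auto simp: twist_sign_def)
    then show ?thesis
      unfolding tw(1)[OF 1] X_def[symmetric] s using K by (simp add: div X_def algebra_simps)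
  next
    case 2
    then have "X * y \<le> 0" "K - 1 \<le> \<bar>X\<bar>" "\<bar>y\<bar> \<le> \<bar>X\<bar> - (K - 1)"
      unfolding twist_II_def e c1 c2 sx by auto
    then have "rot_x K X y = X \<and> rot_y K X y = y + ?s + (X - K * ?s)"
      using sgn_y K unfolding rot by (auto simp: twist_sign_def)
    then show ?thesis
      unfolding tw(2)[OF 2] X_def[symmetric] s using K by (simp add: div X_def algebra_simps)
  next
    case 3
    then have "X * y \<ge> 0" "K - 1 \<le> \<bar>X\<bar>" "\<bar>y\<bar> \<le> \<bar>X\<bar> - (K - 1)"
      unfolding twist_III_def e c1 c2 sx by auto
    then have "rot_x K X y = X - y \<and> rot_y K X y = ?s + (X - K * ?s)"
      using sgn_y' K unfolding rot by (auto simp: twist_sign_def)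
    then show ?thesis
      unfolding tw(3)[OF 3] X_def[symmetric] s using K by (simp add: div X_def algebra_simps)
  next
    case 4
    then have "X * y \<ge> 0 \<and> K - 1 \<le> \<bar>X\<bar> \<and> \<bar>X\<bar> - (K - 1) \<le> \<bar>y\<bar> \<or> \<bar>X\<bar> \<le> K - 1"
      unfolding twist_IV_def e c1 c2 sx by auto
    then have "rot_x K X y = X - y \<and> rot_y K X y = y"
      using sgn_y' K unfolding rot by (auto simp: twist_sign_def)
    then show ?thesis
      unfolding tw(4)[OF 4] X_def[symmetric] s using K by (simp add: div X_def algebra_simps)
  qed
qed

section \<open>The cube, continuity of maps into it, and weighted closeness\<close>

lemma mem_Q_iff: "x \<in> Q \<longleftrightarrow> (\<forall>i\<ge>1. \<bar>x i\<bar> \<le> 1) \<and> x 0 = undefined"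
proof -
  have "{i. i \<notin> {1::nat..}} = {0}" by auto
  then show ?thesis
    by (auto simp: hilbert_cube_def PiE_iff extensional_def abs_le_iff not_le)
qed

lemma mem_pseudo_interior_iff:
  "x \<in> pseudo_interior \<longleftrightarrow> x \<in> Q \<and> (\<forall>i\<ge>1. \<bar>x i\<bar> < 1)"
proof -
  have "x \<in> pseudo_interior \<longleftrightarrow> (\<forall>i\<ge>1. \<bar>x i\<bar> < 1) \<and> x 0 = undefined"
    by (auto simp: pseudo_interior_def PiE_iff extensional_def abs_less_iff not_le)
  then show ?thesis unfolding mem_Q_iff using less_imp_le by blast
qed

lemma continuous_map_coordinate:
  assumes "i \<ge> 1"
  shows "continuous_map hilbert_cube euclideanreal (\<lambda>x. x i)"
proof -
  have "continuous_map hilbert_cube (top_of_set {-1..1}) (\<lambda>x. x i)"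
    unfolding hilbert_cube_def using assms by (intro continuous_map_product_projection) simp
  then show ?thesis by (simp add: continuous_map_in_subtopology)
qed

lemma continuous_map_into_cubeI:
  assumes "\<And>i. i \<ge> 1 \<Longrightarrow> continuous_map X euclideanreal (\<lambda>x. f x i)"
    and "\<And>x. x \<in> topspace X \<Longrightarrow> f x \<in> Q"
  shows "continuous_map X hilbert_cube f"
  unfolding hilbert_cube_def continuous_map_componentwise
proof (intro conjI ballI image_subsetI)
  fix x assume "x \<in> topspace X"
  then show "f x \<in> extensional {1..}" using assms(2)[of x] by (auto simp: hilbert_cube_def PiE_iff)
next
  fix i :: nat assume "i \<in> {1..}"
  then show "continuous_map X (top_of_set {-1..1}) (\<lambda>x. f x i)"
    using assms by (auto simp: continuous_map_in_subtopology mem_Q_iff abs_le_iff)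
qed

lemma compact_space_hilbert_cube: "compact_space hilbert_cube"
  by (simp add: hilbert_cube_def compact_space_product_topology compact_space_subtopology)

lemma Hausdorff_space_hilbert_cube: "Hausdorff_space hilbert_cube"
  by (simp add: hilbert_cube_def Hausdorff_space_product_topology Hausdorff_space_subtopology)

text \<open>The weights are matched to the twist: multiplying coordinate \<open>n\<close> by
  \<open>2 ^ (m - n)\<close> turns its allowance \<open>2 ^ n * c\<close> into
  \<open>2 ^ m * c\<close>, that of coordinate \<open>m\<close>. Thus the estimates for
  \<open>rot\<close> carry over with constants independent of \<open>n\<close> and
  \<open>m\<close>.\<close>

definition weighted_close :: "real \<Rightarrow> (nat \<Rightarrow> real) \<Rightarrow> (nat \<Rightarrow> real) \<Rightarrow> bool" where
  "weighted_close c u v \<longleftrightarrow> (\<forall>j\<ge>1. \<bar>u j - v j\<bar> \<le> 2 ^ j * c)"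

lemma weighted_close_trans:
  assumes "weighted_close c u v" "weighted_close d v w"
  shows "weighted_close (c + d) u w"
  unfolding weighted_close_def
proof (intro allI impI)
  fix j :: nat assume "j \<ge> 1"
  then have "\<bar>u j - v j\<bar> \<le> 2 ^ j * c" "\<bar>v j - w j\<bar> \<le> 2 ^ j * d"
    using assms by (auto simp: weighted_close_def)
  then show "\<bar>u j - w j\<bar> \<le> 2 ^ j * (c + d)" unfolding distrib_left by linarith
qed

lemma weighted_close_sym: "weighted_close c u v \<Longrightarrow> weighted_close c v u"
  by (simp add: weighted_close_def abs_minus_commute)

section \<open>Twists acting on the cube\<close>

context
  fixes n m :: nat
  assumes nm: "0 < n" "n < m"
begin

abbreviation (input) stretch :: real where "stretch \<equiv> 2 ^ (m - n)"

lemma stretch_ge_2: "stretch \<ge> 2"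
  using power_increasing[of 1 "m - n" "2::real"] nm(2) by simp

lemma stretch_scale: "2 ^ n * stretch = 2 ^ m"
  using nm by (simp flip: power_add)

lemma stretch_bound: "x \<in> Q \<Longrightarrow> \<bar>stretch * x n\<bar> \<le> stretch" "x \<in> Q \<Longrightarrow> \<bar>x m\<bar> \<le> 1"
  using nm stretch_ge_2 by (auto simp: mem_Q_iff abs_mult mult_left_le)

lemma cube_twist_eq:
  assumes "x \<in> Q"
  shows "cube_twist n m x =
    x(n := rot_x stretch (stretch * x n) (x m) / stretch, m := rot_y stretch (stretch * x n) (x m))"
  using assms nm twist_eq_rot[of n m "x n" "x m"] by (simp add: cube_twist_def mem_Q_iff)

lemma cube_twist_in_Q:
  assumes "x \<in> Q"
  shows "cube_twist n m x \<in> Q"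
  using reflect_rot_involution(1,2)[OF stretch_ge_2 stretch_bound[OF assms]] assms nm
  unfolding cube_twist_eq[OF assms] by (auto simp: mem_Q_iff)

lemma cube_twist_surj: "cube_twist n m ` Q = Q"
proof
  show "Q \<subseteq> cube_twist n m ` Q"
  proof
    fix y assume y: "y \<in> Q"
    \<comment> \<open>If R reflects coordinate \<open>m\<close> and T is the twist, then R T is an
      involution, so the inverse of T is R T R; the preimage of \<open>y\<close> is built in this
      order.\<close>
    define z where "z = y(m := - y m)"
    define w where "w = cube_twist n m z"
    define x where "x = w(m := - w m)"
    have z: "z \<in> Q" using y nm by (auto simp: z_def mem_Q_iff)
    then have w: "w \<in> Q" unfolding w_def by (rule cube_twist_in_Q)
    then have x: "x \<in> Q" using nm by (auto simp: x_def mem_Q_iff)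
    have "stretch * x n = rot_x stretch (stretch * z n) (z m)"
      "x m = - rot_y stretch (stretch * z n) (z m)"
      using nm by (simp_all add: x_def w_def cube_twist_eq[OF z])
    then have "cube_twist n m x = y"
      unfolding cube_twist_eq[OF x]
      using reflect_rot_involution(3,4)[OF stretch_ge_2 stretch_bound[OF z]] nm
      by (auto simp: fun_eq_iff x_def w_def cube_twist_eq[OF z]) (auto simp: z_def)
    then show "y \<in> cube_twist n m ` Q" using x by blast
  qed
qed (use cube_twist_in_Q in auto)

lemma continuous_map_cube_twist: "continuous_map hilbert_cube hilbert_cube (cube_twist n m)"
proof (rule continuous_map_into_cubeI)
  fix i :: nat assume i: "i \<ge> 1"
  have cont: "continuous_map hilbert_cube euclideanreal (\<lambda>x. x i)" if "i \<ge> 1" for i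
    using that by (rule continuous_map_coordinate)
  have "continuous_map hilbert_cube euclideanreal (\<lambda>x.
    (x(n := rot_x stretch (stretch * x n) (x m) / stretch, m := rot_y stretch (stretch * x n) (x m))) i)"
  proof -
    have "continuous_map hilbert_cube euclideanreal (\<lambda>x. rot_x stretch (stretch * x n) (x m) / stretch)"
      unfolding rot_x_def Let_def
      using nm by (intro continuous_intros continuous_map_real_max cont) auto
    moreover have "continuous_map hilbert_cube euclideanreal (\<lambda>x. rot_y stretch (stretch * x n) (x m))"
      unfolding rot_y_def Let_def
      using nm by (intro continuous_intros continuous_map_real_max continuous_map_real_min cont) auto
    ultimately show ?thesis using cont[OF i] by simp
  qed
  then show "continuous_map hilbert_cube euclideanreal (\<lambda>x. cube_twist n m x i)"
    by (rule continuous_map_eq) (simp add: cube_twist_eq)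
qed (rule cube_twist_in_Q)

text \<open>In the stretched rectangle either side changes by at most 1. This is
  \<open>2 ^ m / 2 ^ m\<close> for coordinate \<open>m\<close>, and after dividing by the stretch it
  is \<open>2 ^ n / 2 ^ m\<close> for coordinate \<open>n\<close>.\<close>

lemma cube_twist_displacement:
  assumes "x \<in> Q"
  shows "weighted_close (1 / 2 ^ m) (cube_twist n m x) x"
  unfolding weighted_close_def cube_twist_eq[OF assms]
proof (intro allI impI)
  fix j
  note r = rot_displacement[OF stretch_ge_2 stretch_bound[OF assms]]
  have "rot_x stretch (stretch * x n) (x m) / stretch - x n =
      (rot_x stretch (stretch * x n) (x m) - stretch * x n) / stretch"
    by (simp add: diff_divide_distrib)
  then have "\<bar>rot_x stretch (stretch * x n) (x m) / stretch - x n\<bar> \<le> 1 / stretch"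
    using r(1) by (simp add: divide_right_mono)
  also have "1 / stretch = 2 ^ n / 2 ^ m"
    using stretch_scale by (simp add: field_simps)
  finally show "\<bar>(x(n := rot_x stretch (stretch * x n) (x m) / stretch,
      m := rot_y stretch (stretch * x n) (x m))) j - x j\<bar> \<le> 2 ^ j * (1 / 2 ^ m)"
    using r(2) by auto
qed

lemma cube_twist_coLipschitz:
  assumes "x \<in> Q" "x' \<in> Q" and close: "weighted_close c (cube_twist n m x) (cube_twist n m x')"
  shows "weighted_close (16 * c) x x'"
proof -
  let ?X = "stretch * x n" and ?X' = "stretch * x' n"
  have *: "\<bar>cube_twist n m x j - cube_twist n m x' j\<bar> \<le> 2 ^ j * c" if "j \<ge> 1" for j
    using close that by (simp add: weighted_close_def)
  have c0: "c \<ge> 0" using *[of 1] by simp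
  have "\<bar>rot_x stretch ?X (x m) - rot_x stretch ?X' (x' m)\<bar> / stretch \<le> 2 ^ n * c"
    using *[of n] nm unfolding cube_twist_eq[OF assms(1)] cube_twist_eq[OF assms(2)]
    by (simp flip: diff_divide_distrib)
  then have "\<bar>rot_x stretch ?X (x m) - rot_x stretch ?X' (x' m)\<bar> \<le> 2 ^ m * c"
    unfolding stretch_scale[symmetric] by (simp add: divide_le_eq mult_ac)
  moreover have "\<bar>rot_y stretch ?X (x m) - rot_y stretch ?X' (x' m)\<bar> \<le> 2 ^ m * c"
    using *[of m] nm unfolding cube_twist_eq[OF assms(1)] cube_twist_eq[OF assms(2)] by simp
  ultimately have "\<bar>?X - ?X'\<bar> \<le> 16 * (2 ^ m * c)" and m: "\<bar>x m - x' m\<bar> \<le> 16 * (2 ^ m * c)"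
    by (rule rot_coLipschitz[OF stretch_ge_2 stretch_bound[OF assms(1)] stretch_bound[OF assms(2)]])+
  moreover have "\<bar>?X - ?X'\<bar> = stretch * \<bar>x n - x' n\<bar>"
    unfolding right_diff_distrib[symmetric] abs_mult by simp
  moreover have "16 * (2 ^ m * c) = stretch * (16 * (2 ^ n * c))"
    unfolding stretch_scale[symmetric] by simp
  ultimately have "stretch * \<bar>x n - x' n\<bar> \<le> stretch * (16 * (2 ^ n * c))"
    by simp
  then have n: "\<bar>x n - x' n\<bar> \<le> 16 * (2 ^ n * c)"
    by (subst (asm) mult_le_cancel_left_pos) auto
  have "\<bar>x j - x' j\<bar> \<le> 16 * (2 ^ j * c)" if "j \<ge> 1" for j
  proof (cases "j = n \<or> j = m")
    case False
    then have "\<bar>x j - x' j\<bar> \<le> 2 ^ j * c"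
      using *[OF that] unfolding cube_twist_eq[OF assms(1)] cube_twist_eq[OF assms(2)] by simp
    also have "\<dots> \<le> 16 * (2 ^ j * c)" using c0 by simp
    finally show ?thesis .
  qed (use n m in auto)
  then show ?thesis by (simp add: weighted_close_def mult_ac)
qed

lemma cube_twist3_in_Q: "x \<in> Q \<Longrightarrow> cube_twist3 n m x \<in> Q"
  by (simp add: cube_twist3_def cube_twist_in_Q)

lemma cube_twist3_surj: "cube_twist3 n m ` Q = Q"
  unfolding cube_twist3_def by (simp only: image_comp[symmetric] cube_twist_surj)

lemma continuous_map_cube_twist3: "continuous_map hilbert_cube hilbert_cube (cube_twist3 n m)"
  unfolding cube_twist3_def
  by (rule continuous_map_compose[OF _ continuous_map_compose]; rule continuous_map_cube_twist)

lemma cube_twist3_displacement: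
  assumes "x \<in> Q"
  shows "weighted_close (3 / 2 ^ m) (cube_twist3 n m x) x"
proof -
  let ?f = "cube_twist n m"
  have "weighted_close (1 / 2 ^ m + (1 / 2 ^ m + 1 / 2 ^ m)) (?f (?f (?f x))) x"
    using assms by (intro weighted_close_trans[OF cube_twist_displacement
        weighted_close_trans[OF cube_twist_displacement cube_twist_displacement]] cube_twist_in_Q)
  then show ?thesis by (simp add: cube_twist3_def add_divide_distrib[symmetric])
qed

lemma cube_twist3_coLipschitz:
  assumes "x \<in> Q" "x' \<in> Q" "weighted_close c (cube_twist3 n m x) (cube_twist3 n m x')"
  shows "weighted_close (4096 * c) x x'"
proof -
  let ?f = "cube_twist n m"
  have "weighted_close (16 * (16 * (16 * c))) x x'"
    using assms by (intro cube_twist_coLipschitz cube_twist_in_Q) (simp_all add: cube_twist3_def)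
  then show ?thesis by simp
qed

lemma cube_twist3_other:
  assumes "j \<noteq> n" "j \<noteq> m"
  shows "cube_twist3 n m x j = x j"
  using assms by (simp add: cube_twist3_def cube_twist_def)

lemma cube_twist3_edge:
  assumes x: "x \<in> Q" and edge: "\<bar>x n\<bar> = 1"
  shows "\<bar>cube_twist3 n m x n\<bar> < 1" "\<bar>cube_twist3 n m x m\<bar> = 1"
proof -
  let ?f = "cube_twist n m"
  define y where "y = ?f x"
  define z where "z = ?f y"
  have y: "y \<in> Q" and z: "z \<in> Q" unfolding z_def y_def by (simp_all add: x cube_twist_in_Q)
  have f: "stretch * ?f u n = rot_x stretch (stretch * u n) (u m)"
    "?f u m = rot_y stretch (stretch * u n) (u m)" if "u \<in> Q" for u
    using nm by (simp_all add: cube_twist_eq[OF that])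
  have m1: "\<bar>x m\<bar> \<le> 1" using stretch_bound(2)[OF x] .
  \<comment> \<open>The image \<open>K - 2 - Y\<close> lies between \<open>K - 3\<close> and
    \<open>K - 1\<close>, and \<open>K \<ge> 2\<close> gives \<open>K - 3 \<ge> 1 - K\<close>: the
    opposite edge is avoided too.\<close>
  then have bound: "\<bar>stretch - 2 - x m\<bar> \<le> stretch - 1" "\<bar>2 - stretch - x m\<bar> \<le> stretch - 1"
    using stretch_ge_2 unfolding abs_le_iff by linarith+
  consider "x n = 1" | "x n = -1" using edge by linarith
  then have "\<bar>stretch * ?f z n\<bar> \<le> stretch - 1 \<and> \<bar>?f z m\<bar> = 1"
  proof cases
    case 1
    show ?thesis
      using rot_cubed_edge[OF stretch_ge_2, of "x m"] m1 bound
      unfolding f[OF z] unfolding z_def f[OF y] unfolding y_def f[OF x] 1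
      by simp
  next
    case 2
    show ?thesis
      using rot_cubed_edge[OF stretch_ge_2, of "- x m"] m1 bound
        rot_minus[of stretch stretch "- x m"]
      unfolding f[OF z] unfolding z_def f[OF y] unfolding y_def f[OF x] 2
      by (simp add: rot_minus)
  qed
  then have a: "stretch * \<bar>?f z n\<bar> < stretch * 1" and b: "\<bar>?f z m\<bar> = 1"
    unfolding abs_mult abs_of_pos[OF zero_less_power[OF zero_less_numeral]] by linarith+
  from a have "\<bar>?f z n\<bar> < 1" by (subst (asm) mult_less_cancel_left_pos) auto
  with b show "\<bar>cube_twist3 n m x n\<bar> < 1" "\<bar>cube_twist3 n m x m\<bar> = 1"
    by (simp_all add: cube_twist3_def z_def y_def)
qed

end

lemma cube_dist_agree:
  assumes "u \<in> Q" "v \<in> Q" and agree: "\<And>j. 1 \<le> j \<Longrightarrow> j \<le> i \<Longrightarrow> u j = v j"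
  shows "0 \<le> cube_dist u v" "cube_dist u v \<le> 2 / 2 ^ i"
proof -
  let ?t = "\<lambda>j. \<bar>u (Suc j) - v (Suc j)\<bar> / 2 ^ Suc j"
  \<comment> \<open>Index \<open>j\<close> stands for coordinate \<open>Suc j\<close>, so the first
    \<open>i\<close> terms vanish, and every other term is at most \<open>2 / 2 ^ Suc j\<close>,
    which is \<open>(1/2) ^ j\<close>.\<close>
  let ?g = "\<lambda>j. if j < i then 0 else (1/2) ^ j :: real"
  have le: "?t j \<le> ?g j" for j
  proof (cases "j < i")
    case True
    then show ?thesis using agree[of "Suc j"] by simp
  next
    case False
    have "\<bar>u (Suc j) - v (Suc j)\<bar> \<le> \<bar>u (Suc j)\<bar> + \<bar>v (Suc j)\<bar>" by simp
    also have "\<dots> \<le> 2" using assms(1,2) unfolding mem_Q_iff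
      by (metis add_mono le_add1 one_add_one plus_1_eq_Suc)
    finally show ?thesis using False by (simp add: field_simps)
  qed
  have "(\<lambda>j. ?g (j + i)) sums ((1/2) ^ i * 2)"
    using sums_mult[OF geometric_sums[of "1/2::real"], of "(1/2) ^ i"]
    by (simp add: power_add mult.commute)
  then have "?g sums ((1/2) ^ i * 2 + (\<Sum>j<i. ?g j))"
    by (rule iffD1[OF sums_iff_shift])
  then have g: "?g sums (2 / 2 ^ i)" by (simp add: power_one_over field_simps)
  have t: "summable ?t"
    by (rule summable_comparison_test[OF _ sums_summable[OF g]]) (use le in \<open>auto simp del: power_Suc\<close>)
  show "0 \<le> cube_dist u v" unfolding cube_dist_def by (rule suminf_nonneg[OF t]) simp
  show "cube_dist u v \<le> 2 / 2 ^ i"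
    unfolding cube_dist_def sums_unique[OF g] by (rule suminf_le[OF le t sums_summable[OF g]])
qed

section \<open>The index sequences\<close>

locale twist_scheme =
  fixes J :: "nat set"
  assumes J_nonempty: "J \<noteq> {}" and J_pos: "0 \<notin> J"
begin

text \<open>The factor 16 makes \<open>2 ^ m_seq k\<close> outgrow the constants \<open>4096 ^ k = 2 ^ (12 * k)\<close> of
  \<open>stage_coLipschitz\<close>; the offset gives \<open>n_seq 1 < m_seq 1\<close>. All later inequalities
  \<open>n_seq k < m_seq k\<close> then hold automatically, since the least pending index at step \<open>k\<close> is at most
  \<open>m_seq (k - 1)\<close>.\<close>

definition m_seq :: "nat \<Rightarrow> nat" where
  "m_seq k = 16 * ((LEAST j. j \<in> J) + k)"

definition indices :: "nat set" where
  "indices = J \<union> m_seq ` {1..}"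

text \<open>A closed form of the recursion: as \<open>m_seq i\<close> exceeds
  \<open>n_seq i\<close>, each new index is pending before its turn comes, so the successive minima
  enumerate \<open>indices\<close> in increasing order. \<open>enumerate\<close> counts from 0,
  hence \<open>k - 1\<close>; as \<open>n_seq 0 = n_seq 1\<close>, strict monotonicity holds only
  from 1 on.\<close>

definition n_seq :: "nat \<Rightarrow> nat" where
  "n_seq k = enumerate indices (k - 1)"

lemma m_seq_less_iff: "m_seq i < m_seq k \<longleftrightarrow> i < k"
  by (simp add: m_seq_def)

lemma infinite_indices: "infinite indices"
proof -
  have "inj m_seq" by (auto simp: inj_def m_seq_def)
  then have "infinite (m_seq ` {1..})" by (simp add: finite_image_iff inj_on_subset infinite_Ici)
  then show ?thesis by (simp add: indices_def)
qed

lemma n_seq_in: "n_seq k \<in> indices"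
  by (simp add: n_seq_def enumerate_in_set infinite_indices)

lemma n_seq_pos: "n_seq k > 0"
  using n_seq_in[of k] J_pos by (auto simp: indices_def m_seq_def intro!: gr0I)

lemma n_seq_less_iff: "1 \<le> i \<Longrightarrow> 1 \<le> k \<Longrightarrow> n_seq i < n_seq k \<longleftrightarrow> i < k"
  using infinite_indices by (auto simp: n_seq_def)

lemma n_seq_ge: "k \<le> n_seq k"
proof (induction k)
  case (Suc k)
  show ?case
  proof (cases "k = 0")
    case True
    then show ?thesis using n_seq_pos[of 1] by simp
  next
    case False
    then have "n_seq k < n_seq (Suc k)" by (simp add: n_seq_less_iff)
    with Suc show ?thesis by simp
  qed
qed simp

lemma n_seq_1: "n_seq 1 = (LEAST j. j \<in> J)"
proof -
  have J: "(LEAST j. j \<in> J) \<in> J" using J_nonempty by (metis LeastI_ex all_not_in_conv)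
  have "(LEAST j. j \<in> indices) = (LEAST j. j \<in> J)"
  proof (rule Least_equality)
    fix y assume "y \<in> indices"
    then show "(LEAST j. j \<in> J) \<le> y"
      by (auto simp: indices_def m_seq_def intro: Least_le)
  qed (use J in \<open>simp add: indices_def\<close>)
  then show ?thesis by (simp add: n_seq_def enumerate_0)
qed

lemma n_seq_Suc_le: "j \<in> indices \<Longrightarrow> 1 \<le> k \<Longrightarrow> n_seq k < j \<Longrightarrow> n_seq (Suc k) \<le> j"
  using enumerate_Suc''[OF infinite_indices, of "k - 1"]
  by (auto simp: n_seq_def intro: Least_le)

lemma n_seq_less_m_seq: "1 \<le> k \<Longrightarrow> n_seq k < m_seq k"
proof (induction k rule: nat_induct_at_least)
  case base
  show ?case using n_seq_pos[of 1] by (simp only: n_seq_1 m_seq_def) simp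
next
  case (Suc k)
  have "m_seq k \<in> indices" using Suc.hyps by (simp add: indices_def)
  then have "n_seq (Suc k) \<le> m_seq k" using Suc by (intro n_seq_Suc_le)
  also have "\<dots> < m_seq (Suc k)" by (simp add: m_seq_less_iff)
  finally show ?case .
qed

lemma n_seq_range: "j \<in> indices \<Longrightarrow> \<exists>k\<ge>1. n_seq k = j"
  using enumerate_Ex[OF , of indices j] infinite_indices
  by (metis diff_Suc_1 le_add1 n_seq_def plus_1_eq_Suc)

definition pending :: "nat \<Rightarrow> nat set" where
  "pending k = (m_seq ` {1..k} \<union> J) - n_seq ` {1..k}"

text \<open>The danger is an index \<open>m_seq i\<close> that comes due before step
  \<open>i\<close> creates it. But \<open>n_seq i < m_seq i = n_seq (Suc k)\<close> forces
  \<open>i \<le> k\<close>.\<close>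

lemma n_seq_in_pending: "n_seq (Suc k) \<in> pending k"
proof -
  have "n_seq (Suc k) \<in> m_seq ` {1..k} \<union> J"
  proof (cases "n_seq (Suc k) \<in> J")
    case False
    then obtain i where i: "i \<ge> 1" "n_seq (Suc k) = m_seq i"
      using n_seq_in[of "Suc k"] by (auto simp: indices_def)
    have "n_seq i < n_seq (Suc k)" using n_seq_less_m_seq[OF i(1)] i(2) by simp
    then have "i \<le> k" using i(1) by (simp add: n_seq_less_iff)
    then show ?thesis using i by auto
  qed simp
  moreover have "n_seq (Suc k) \<notin> n_seq ` {1..k}"
    using n_seq_less_iff[of _ "Suc k"] by fastforce
  ultimately show ?thesis by (simp add: pending_def)
qed

lemma n_seq_eq_Least: "n_seq (Suc k) = (LEAST j. j \<in> pending k)"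
proof (rule Least_equality[symmetric])
  fix j assume j: "j \<in> pending k"
  then have "j \<in> indices" by (auto simp: pending_def indices_def)
  then obtain i where i: "i \<ge> 1" "n_seq i = j" using n_seq_range by blast
  with j have "\<not> i \<le> k" by (auto simp: pending_def)
  then show "n_seq (Suc k) \<le> j"
    using i n_seq_less_iff[of i "Suc k"] by fastforce
qed (rule n_seq_in_pending)

lemma twist_sequences: "twist_sequences J n_seq m_seq"
proof -
  have four: "m_seq k \<in> {4 * i |i. i \<ge> 1}" if "k \<ge> 1" for k
  proof -
    have "m_seq k = 4 * (4 * ((LEAST j. j \<in> J) + k))" by (simp add: m_seq_def)
    moreover have "1 \<le> 4 * ((LEAST j. j \<in> J) + k)" using that by simp
    ultimately show ?thesis by blast
  qed
  have Least: "n_seq k = (LEAST j. j \<in> (m_seq ` {1..<k} \<union> J) - n_seq ` {1..<k})" if "k \<ge> 2" for k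
    using n_seq_eq_Least[of "k - 1"] that
    by (cases k) (auto simp: pending_def atLeastLessThanSuc_atLeastAtMost)
  have later: "m_seq k \<in> {4 * i |i. i \<ge> 1}" "m_seq (k - 1) < m_seq k" "n_seq k < m_seq k"
    if "k \<ge> 2" for k
    using that four[of k] n_seq_less_m_seq[of k] by (simp_all add: m_seq_less_iff)
  have "n_seq k > 0 \<and> m_seq k > 0" if "k \<ge> 1" for k
    using that n_seq_pos by (simp add: m_seq_def)
  with later Least n_seq_1 four[of 1] n_seq_less_m_seq[of 1] show ?thesis
    unfolding twist_sequences_def by blast
qed

section \<open>The stages, their limit, and the boundary coordinates\<close>

definition stage :: "nat \<Rightarrow> (nat \<Rightarrow> real) \<Rightarrow> nat \<Rightarrow> real" where
  "stage = twist_comp n_seq m_seq"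

lemma stage_Suc: "stage (Suc k) x = cube_twist3 (n_seq (Suc k)) (m_seq (Suc k)) (stage k x)"
  by (simp add: stage_def)

lemmas step_indices = n_seq_pos n_seq_less_m_seq[of "Suc k" for k, simplified]

lemma stage_in_Q: "x \<in> Q \<Longrightarrow> stage k x \<in> Q"
  by (induction k) (auto simp: stage_Suc cube_twist3_in_Q step_indices, simp add: stage_def)

lemma stage_surj: "stage k ` Q = Q"
proof (induction k)
  case (Suc k)
  have "stage (Suc k) ` Q = cube_twist3 (n_seq (Suc k)) (m_seq (Suc k)) ` stage k ` Q"
    by (auto simp: stage_Suc image_iff)
  then show ?case by (simp only: Suc cube_twist3_surj[OF step_indices])
qed (simp add: stage_def)

lemma continuous_map_stage: "continuous_map hilbert_cube hilbert_cube (stage k)"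
proof (induction k)
  case (Suc k)
  show ?case
    using continuous_map_compose[OF Suc continuous_map_cube_twist3[OF step_indices]]
    unfolding stage_def twist_comp.simps .
qed (simp add: stage_def)

lemma stage_coLipschitz:
  assumes "x \<in> Q" "y \<in> Q"
  shows "weighted_close c (stage k x) (stage k y) \<Longrightarrow> weighted_close (4096 ^ k * c) x y"
proof (induction k arbitrary: c)
  case (Suc k)
  have "weighted_close (4096 * c) (stage k x) (stage k y)"
    using cube_twist3_coLipschitz[OF step_indices stage_in_Q[OF assms(1)] stage_in_Q[OF assms(2)]]
      Suc.prems by (simp add: stage_Suc)
  then show ?case using Suc.IH[of "4096 * c"] by (simp add: mult_ac)
qed (simp add: stage_def)

text \<open>Step \<open>Suc i\<close> touches only the coordinates \<open>n_seq (Suc i)\<close> and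
  \<open>m_seq (Suc i)\<close>, and both are at least \<open>Suc i\<close>.\<close>

lemma stage_stable: "j \<le> i \<Longrightarrow> stage (Suc i) x j = stage i x j"
proof -
  assume "j \<le> i"
  then have "j < n_seq (Suc i)" using n_seq_ge[of "Suc i"] by simp
  moreover have "n_seq (Suc i) < m_seq (Suc i)" by (simp add: step_indices)
  ultimately show ?thesis using cube_twist3_other[OF step_indices, of j i] by (simp add: stage_Suc)
qed

text \<open>Coordinate \<open>j\<close> is final after stage \<open>j\<close>, so the limit is a
  diagonal and exists without any convergence argument. It depends on \<open>J\<close> alone. At
  index 0 it keeps the value \<open>undefined\<close> of points of the cube.\<close>

definition limit :: "(nat \<Rightarrow> real) \<Rightarrow> nat \<Rightarrow> real" where
  "limit x j = stage j x j"

lemma limit_eq_stage: "j \<le> i \<Longrightarrow> limit x j = stage i x j"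
  by (induction i rule: dec_induct) (auto simp: limit_def stage_stable)

lemma limit_in_Q: "x \<in> Q \<Longrightarrow> limit x \<in> Q"
  using stage_in_Q by (simp add: mem_Q_iff limit_def)

lemma map_dist_limit: "(\<lambda>i. map_dist (stage i) limit) \<longlonglongrightarrow> 0"
proof (rule tendsto_sandwich)
  have Q0: "Q \<noteq> {}"
    by (auto simp: hilbert_cube_def PiE_eq_empty_iff)
  have d: "0 \<le> cube_dist (stage i x) (limit x)" "cube_dist (stage i x) (limit x) \<le> 2 / 2 ^ i"
    if "x \<in> Q" for i x
    using cube_dist_agree[of "stage i x" "limit x" i] that
    by (auto simp: stage_in_Q limit_in_Q limit_eq_stage)
  show "\<forall>\<^sub>F i in sequentially. map_dist (stage i) limit \<le> 2 / 2 ^ i"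
    unfolding map_dist_def using Q0 d(2) by (intro always_eventually allI cSUP_least)
  show "\<forall>\<^sub>F i in sequentially. 0 \<le> map_dist (stage i) limit"
  proof (intro always_eventually allI)
    fix i
    obtain x where x: "x \<in> Q" using Q0 by blast
    have "bdd_above ((\<lambda>x. cube_dist (stage i x) (limit x)) ` Q)"
      using d(2) by (intro bdd_aboveI2)
    then have "cube_dist (stage i x) (limit x) \<le> map_dist (stage i) limit"
      unfolding map_dist_def by (intro cSUP_upper x)
    then show "0 \<le> map_dist (stage i) limit" using d(1)[OF x] order_trans by blast
  qed
  show "(\<lambda>i. 2 / 2 ^ i :: real) \<longlonglongrightarrow> 0"
    using tendsto_mult_right_zero[OF LIMSEQ_power_zero[of "1/2 :: real"], of 2]
    by (simp add: power_one_over)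
qed simp

text \<open>Each coordinate of the limit is a coordinate of one continuous stage, which suffices in
  the product topology.\<close>

lemma continuous_map_limit: "continuous_map hilbert_cube hilbert_cube limit"
proof (rule continuous_map_into_cubeI)
  fix i :: nat assume "i \<ge> 1"
  then show "continuous_map hilbert_cube euclideanreal (\<lambda>x. limit x i)"
    using continuous_map_compose[OF continuous_map_stage continuous_map_coordinate]
    by (simp add: limit_def o_def)
qed (rule limit_in_Q)

text \<open>The bound is written as a difference so that the displacements of consecutive steps
  telescope in the induction.\<close>

lemma stage_displacement:
  assumes "x \<in> Q" "i \<le> l"
  shows "weighted_close (3 * ((1/65536) ^ i - (1/65536) ^ l)) (stage l x) (stage i x)"
  using assms(2)
proof (induction l rule: dec_induct)
  case base
  show ?case by (simp add: weighted_close_def)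
next
  case (step l)
  \<comment> \<open>The least element of \<open>J\<close> is positive and contributes the additional
    16; the exponent \<open>16 * (l + 2)\<close> leaves room to absorb the step into a difference of
    powers of 1/65536 = 2^(-16).\<close>
  have "16 * Suc l + 16 \<le> m_seq (Suc l)"
    using n_seq_pos[of 1] unfolding n_seq_1 m_seq_def by simp
  then have "(2::real) ^ (16 * Suc l + 16) \<le> 2 ^ m_seq (Suc l)" by (intro power_increasing) auto
  then have "3 / 2 ^ m_seq (Suc l) \<le> 3 / (2::real) ^ (16 * Suc l + 16)"
    by (intro divide_left_mono) auto
  also have "\<dots> = 3 * (1/65536) ^ (l + 2)"
    by (simp add: power_add power_mult power_one_over)
  also have "\<dots> \<le> 3 * ((1/65536) ^ l - (1/65536) ^ Suc l)"
    by simp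
  finally have le: "3 / 2 ^ m_seq (Suc l) \<le> 3 * ((1/65536) ^ l - (1/65536 :: real) ^ Suc l)" .
  have "weighted_close (3 / 2 ^ m_seq (Suc l)) (stage (Suc l) x) (stage l x)"
    unfolding stage_Suc by (intro cube_twist3_displacement stage_in_Q assms n_seq_pos n_seq_less_m_seq) simp
  then have "weighted_close (3 * ((1/65536) ^ l - (1/65536) ^ Suc l)) (stage (Suc l) x) (stage l x)"
    unfolding weighted_close_def by (meson le mult_left_mono order_trans zero_le_numeral zero_le_power)
  from weighted_close_trans[OF this step.IH] show ?case by (simp add: algebra_simps)
qed

lemma limit_displacement:
  assumes "x \<in> Q"
  shows "weighted_close (3 * (1/65536) ^ i) (limit x) (stage i x)"
  unfolding weighted_close_def
proof (intro allI impI)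
  fix j :: nat assume "j \<ge> 1"
  \<comment> \<open>From stage \<open>j\<close> on, coordinate \<open>j\<close> is that of the
    limit; the maximum is also past \<open>i\<close>, and the telescoped bound does not grow with
    \<open>?l\<close>.\<close>
  let ?l = "max i j"
  have "\<bar>limit x j - stage i x j\<bar> = \<bar>stage ?l x j - stage i x j\<bar>"
    by (simp add: limit_eq_stage[of j ?l])
  also have "\<dots> \<le> 2 ^ j * (3 * ((1/65536) ^ i - (1/65536) ^ ?l))"
    using stage_displacement[OF assms, of i ?l] \<open>j \<ge> 1\<close> by (simp add: weighted_close_def)
  also have "\<dots> \<le> 2 ^ j * (3 * (1/65536) ^ i)" by (intro mult_left_mono) auto
  finally show "\<bar>limit x j - stage i x j\<bar> \<le> 2 ^ j * (3 * (1/65536) ^ i)" .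
qed

text \<open>Points with the same limit have \<open>i\<close>-th stages within
  \<open>6 * (1/65536) ^ i\<close> of each other. Undoing \<open>i\<close> stages costs
  \<open>4096 ^ i\<close>, and 4096/65536 = 1/16, so the bound on their own distance still tends to
  0.\<close>

lemma inj_on_limit: "inj_on limit Q"
proof (rule inj_onI)
  fix x y assume x: "x \<in> Q" and y: "y \<in> Q" and eq: "limit x = limit y"
  have close: "weighted_close (6 * (1/16) ^ i) x y" for i
  proof -
    have "weighted_close (3 * (1/65536) ^ i + 3 * (1/65536) ^ i) (stage i x) (stage i y)"
      using weighted_close_trans[OF weighted_close_sym[OF limit_displacement[OF x]]
          limit_displacement[OF y, folded eq]] .
    then have "weighted_close (4096 ^ i * (3 * (1/65536) ^ i + 3 * (1/65536) ^ i)) x y"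
      by (rule stage_coLipschitz[OF x y])
    also have "4096 ^ i * (3 * (1/65536) ^ i + 3 * (1/65536) ^ i) = 6 * (4096 * (1/65536 :: real)) ^ i"
      unfolding power_mult_distrib by simp
    finally show ?thesis by simp
  qed
  show "x = y"
  proof
    fix j
    show "x j = y j"
    proof (cases "j = 0")
      case False
      have "(\<lambda>i. 2 ^ j * 6 * (1/16 :: real) ^ i) \<longlonglongrightarrow> 0"
        using tendsto_mult_right_zero[OF LIMSEQ_power_zero[of "1/16 :: real"]] by simp
      moreover have "\<bar>x j - y j\<bar> \<le> 2 ^ j * 6 * (1/16) ^ i" for i
        using close[of i] False by (simp add: weighted_close_def mult.assoc)
      ultimately have "\<bar>x j - y j\<bar> \<le> 0" using LIMSEQ_le_const by blast
      then show ?thesis by simp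
    qed (use x y in \<open>simp add: mem_Q_iff\<close>)
  qed
qed

lemma limit_surj: "limit ` Q = Q"
proof
  have "compactin hilbert_cube (limit ` Q)"
    using image_compactin[OF _ continuous_map_limit] compact_space_hilbert_cube
    by (simp add: compact_space_def)
  then have closed: "closedin hilbert_cube (limit ` Q)"
    using compactin_imp_closedin Hausdorff_space_hilbert_cube by blast
  show "Q \<subseteq> limit ` Q"
  proof
    fix y assume y: "y \<in> Q"
    have "\<exists>z\<in>limit ` Q. z \<in> T" if T: "y \<in> T" "openin hilbert_cube T" for T
    proof -
      \<comment> \<open>Density: a basic neighbourhood of \<open>y\<close> restricts only
        coordinates up to some \<open>N\<close>. There the limit agrees with stage \<open>N\<close>,
        which is onto and so takes the value \<open>y\<close>.\<close>
      obtain U where U: "finite {i \<in> {1..}. U i \<noteq> topspace (top_of_set {-1..1::real})}"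
        "y \<in> PiE {1..} U" "PiE {1..} U \<subseteq> T"
        using T unfolding hilbert_cube_def openin_product_topology_alt by blast
      obtain N where "\<forall>i\<in>{i \<in> {1..}. U i \<noteq> topspace (top_of_set {-1..1::real})}. i \<le> N"
        using U(1) unfolding finite_nat_set_iff_bounded_le by blast
      then have N: "i \<le> N" if "i \<ge> 1" "U i \<noteq> {-1..1}" for i using that by simp
      have "y \<in> stage N ` Q" unfolding stage_surj by (rule y)
      then obtain x where x: "x \<in> Q" "stage N x = y" by (elim imageE) simp
      have "limit x i \<in> U i" if "i \<ge> 1" for i
      proof (cases "i \<le> N")
        case True
        then show ?thesis using x(2) U(2) that by (auto simp: limit_eq_stage)
      next
        case False
        then have "U i = {-1..1}" using N that by blast
        then show ?thesis using limit_in_Q[OF x(1)] that by (auto simp: mem_Q_iff abs_le_iff)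
      qed
      moreover have "limit x \<in> extensional {1..}"
        using limit_in_Q[OF x(1)] by (auto simp: hilbert_cube_def PiE_iff)
      ultimately have "limit x \<in> PiE {1..} U" by (simp add: PiE_iff)
      then have "limit x \<in> T" using U(3) by blast
      then show ?thesis using x(1) by blast
    qed
    then have "y \<in> hilbert_cube closure_of (limit ` Q)" using y by (auto simp: in_closure_of)
    then show "y \<in> limit ` Q" using closed by (simp add: closure_of_closedin)
  qed
qed (use limit_in_Q in auto)

lemma homeomorphic_map_limit: "homeomorphic_map hilbert_cube hilbert_cube limit"
  by (intro continuous_imp_homeomorphic_map compact_space_hilbert_cube Hausdorff_space_hilbert_cube
      continuous_map_limit limit_surj inj_on_limit)

text \<open>The invariant of the construction: by \<open>cube_twist3_edge\<close>, each step frees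
  coordinate \<open>n_seq (Suc k)\<close> and puts coordinate \<open>m_seq (Suc k)\<close> on the
  boundary, whether or not it was there before.\<close>

lemma stage_boundary_indices:
  assumes p: "p \<in> Q" and J: "J = boundary_indices p" and "j \<ge> 1"
  shows "\<bar>stage k p j\<bar> = 1 \<longleftrightarrow> j \<in> pending k"
  using assms(3)
proof (induction k arbitrary: j)
  case 0
  then have "j \<in> J \<longleftrightarrow> \<bar>p j\<bar> = 1" unfolding J by (auto simp: boundary_indices_def)
  then show ?case by (simp add: stage_def pending_def)
next
  case (Suc k)
  let ?n = "n_seq (Suc k)" and ?m = "m_seq (Suc k)"
  have nm: "0 < ?n" "?n < ?m" by (simp_all add: step_indices)
  have "\<bar>stage k p ?n\<bar> = 1" using Suc.IH[of ?n] n_seq_in_pending nm(1) by simp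
  note edge = cube_twist3_edge[OF nm stage_in_Q[OF p] this]
  \<comment> \<open>The new index exceeds \<open>n_seq (Suc k)\<close>, hence all indices treated so
    far, so it is not removed from the pending set.\<close>
  have m: "?m \<notin> n_seq ` {1..Suc k}"
    using nm(2) n_seq_less_iff[of "Suc k"] by fastforce
  have pend: "pending (Suc k) = insert ?m (pending k) - {?n}"
    using m unfolding pending_def by (auto simp: atLeastAtMostSuc_conv)
  consider "j = ?n" | "j = ?m" | "j \<noteq> ?n" "j \<noteq> ?m" by blast
  then show ?case
  proof cases
    case 3
    then show ?thesis using Suc.IH[OF Suc.prems] by (simp add: pend stage_Suc cube_twist3_other[OF nm])
  qed (use edge nm in \<open>auto simp: pend stage_Suc\<close>)
qed

lemma limit_in_pseudo_interior:
  assumes p: "p \<in> Q" and J: "J = boundary_indices p"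
  shows "limit p \<in> pseudo_interior"
  unfolding mem_pseudo_interior_iff
proof (intro conjI limit_in_Q p allI impI)
  fix j :: nat assume j: "j \<ge> 1"
  \<comment> \<open>The stage \<open>l\<close> must be late enough for coordinate \<open>j\<close>
    to be final and, if \<open>j\<close> ever becomes pending, to have been treated.\<close>
  obtain l where l: "j \<le> l" "j \<notin> pending l"
  proof (cases "j \<in> indices")
    case True
    then obtain k where "k \<ge> 1" "n_seq k = j" using n_seq_range by blast
    then show ?thesis using that[of "max j k"] by (auto simp: pending_def)
  next
    case False
    then have "j \<notin> pending j" by (auto simp: pending_def indices_def)
    then show ?thesis using that by blast
  qed
  have "\<bar>stage l p j\<bar> \<noteq> 1" using stage_boundary_indices[OF p J j] l(2) by blast
  moreover have "\<bar>stage l p j\<bar> \<le> 1" using stage_in_Q[OF p, of l] j by (simp add: mem_Q_iff)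
  ultimately show "\<bar>limit p j\<bar> < 1" using l(1) by (simp add: limit_eq_stage)
qed

end

lemma ex_type_B_into_pseudo_interior:
  assumes "p \<in> pseudo_boundary"
  shows "\<exists>f. type_B f \<and> f p \<in> pseudo_interior"
proof -
  have p: "p \<in> Q" "p \<notin> pseudo_interior" using assms by (auto simp: pseudo_boundary_def)
  interpret twist_scheme "boundary_indices p"
  proof
    obtain j where "j \<ge> 1" "\<bar>p j\<bar> \<le> 1" "\<not> \<bar>p j\<bar> < 1"
      using p by (auto simp: mem_pseudo_interior_iff mem_Q_iff)
    then have "j \<in> boundary_indices p" by (auto simp: boundary_indices_def abs_if split: if_splits)
    then show "boundary_indices p \<noteq> {}" by blast
  qed (simp add: boundary_indices_def)
  have "type_B limit"
    unfolding type_B_def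
    using homeomorphic_map_limit assms twist_sequences map_dist_limit[unfolded stage_def] by blast
  then show ?thesis using limit_in_pseudo_interior[OF p(1)] by blast
qed

section \<open>Maps of type (A)\<close>

lemma pl_map_range:
  assumes "-1 < a" "a < 1" "-1 < b" "b < 1" "-1 \<le> t" "t \<le> 1"
  shows "-1 \<le> pl_map a b t" "pl_map a b t \<le> 1"
    and "pl_map a b t \<le> b \<longleftrightarrow> t \<le> a"
proof -
  define c d where "c = (b + 1) / (a + 1)" and "d = (1 - b) / (1 - a)"
  have pos: "c > 0" "d > 0" and ends: "(a + 1) * c = b + 1" "(1 - a) * d = 1 - b"
    using assms by (simp_all add: c_def d_def)
  have "(t + 1) * c \<le> (a + 1) * c \<longleftrightarrow> t \<le> a" "(t - a) * d \<le> (1 - a) * d"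
    "(t + 1) * c \<ge> 0" "t > a \<Longrightarrow> (t - a) * d > 0"
    using pos assms(5,6) by simp_all
  then show "-1 \<le> pl_map a b t" "pl_map a b t \<le> 1" "pl_map a b t \<le> b \<longleftrightarrow> t \<le> a"
    using assms ends unfolding pl_map_def c_def[symmetric] d_def[symmetric] by auto
qed

text \<open>A point lies left of the break \<open>a\<close> exactly when its image lies left of the
  break \<open>b\<close>, so each linear branch is undone by the matching branch.\<close>

lemma pl_map_inverse:
  assumes "-1 < a" "a < 1" "-1 < b" "b < 1" "-1 \<le> t" "t \<le> 1"
  shows "pl_map b a (pl_map a b t) = t"
  using pl_map_range(3)[OF assms] assms
  by (subst pl_map_def) (auto simp: pl_map_def)

text \<open>A form without cases, from which continuity follows by the rules for \<open>min\<close>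
  and \<open>max\<close>.\<close>

lemma pl_map_eq:
  assumes "-1 < a" "a < 1"
  shows "pl_map a b t =
    (min t a + 1) * ((b + 1) / (a + 1)) + (max t a - a) * ((1 - b) / (1 - a)) - 1"
  using assms by (auto simp: pl_map_def min_def max_def)

definition pl_product :: "(nat \<Rightarrow> real) \<Rightarrow> (nat \<Rightarrow> real) \<Rightarrow> (nat \<Rightarrow> real) \<Rightarrow> nat \<Rightarrow> real" where
  "pl_product a b x = (\<lambda>i\<in>{1..}. pl_map (a i) (b i) (x i))"

lemma pseudo_interiorD:
  assumes "a \<in> pseudo_interior" "i \<ge> 1"
  shows "-1 < a i" "a i < 1"
  using assms by (auto simp: pseudo_interior_def PiE_iff)

lemma cubeD:
  assumes "x \<in> Q" "i \<ge> 1"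
  shows "-1 \<le> x i" "x i \<le> 1"
  using assms by (auto simp: mem_Q_iff abs_le_iff)

lemma pl_product_in_Q:
  assumes "a \<in> pseudo_interior" "b \<in> pseudo_interior" "x \<in> Q"
  shows "pl_product a b x \<in> Q"
  using pl_map_range(1,2)[OF pseudo_interiorD[OF assms(1)] pseudo_interiorD[OF assms(2)] cubeD[OF assms(3)]]
  by (auto simp: mem_Q_iff pl_product_def abs_le_iff)

lemma continuous_map_pl_product:
  assumes "a \<in> pseudo_interior" "b \<in> pseudo_interior"
  shows "continuous_map hilbert_cube hilbert_cube (pl_product a b)"
proof (rule continuous_map_into_cubeI)
  fix i :: nat assume i: "i \<ge> 1"
  have "continuous_map hilbert_cube euclideanreal (\<lambda>x. (min (x i) (a i) + 1) * ((b i + 1) / (a i + 1))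
      + (max (x i) (a i) - a i) * ((1 - b i) / (1 - a i)) - 1)"
    by (intro continuous_map_diff continuous_map_add continuous_map_real_mult
        continuous_map_real_max continuous_map_real_min continuous_map_coordinate i
        continuous_map_const[THEN iffD2]) auto
  then show "continuous_map hilbert_cube euclideanreal (\<lambda>x. pl_product a b x i)"
    using i by (simp add: pl_product_def pl_map_eq[OF pseudo_interiorD[OF assms(1) i]])
qed (rule pl_product_in_Q[OF assms])

lemma pl_product_inverse:
  assumes "a \<in> pseudo_interior" "b \<in> pseudo_interior" "x \<in> Q"
  shows "pl_product b a (pl_product a b x) = x"
proof
  fix i
  show "pl_product b a (pl_product a b x) i = x i"
    using pl_map_inverse[OF pseudo_interiorD[OF assms(1)] pseudo_interiorD[OF assms(2)]
        cubeD[OF assms(3)], of i] assms(3)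
    by (cases "i = 0") (auto simp: pl_product_def mem_Q_iff)
qed

lemma homeomorphic_map_pl_product:
  assumes "a \<in> pseudo_interior" "b \<in> pseudo_interior"
  shows "homeomorphic_map hilbert_cube hilbert_cube (pl_product a b)"
  using assms
  by (auto simp: homeomorphic_map_maps homeomorphic_maps_def pl_product_inverse
      intro!: exI[of _ "pl_product b a"] continuous_map_pl_product)

lemma ex_type_A_pseudo_interior:
  assumes "a \<in> pseudo_interior" "b \<in> pseudo_interior"
  shows "\<exists>f. type_A f \<and> homeomorphic_map hilbert_cube hilbert_cube f \<and> f a = b"
proof (intro exI conjI)
  show "type_A (pl_product a b)" using assms by (auto simp: type_A_def pl_product_def)
  show "homeomorphic_map hilbert_cube hilbert_cube (pl_product a b)"
    using assms by (rule homeomorphic_map_pl_product)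
  show "pl_product a b a = b"
  proof
    fix i
    show "pl_product a b a i = b i"
      using pseudo_interiorD[OF assms(1), of i] assms(2)
      by (cases "i = 0") (auto simp: pl_product_def pl_map_def mem_pseudo_interior_iff mem_Q_iff)
  qed
qed

section \<open>Compositions that carry one point to another\<close>

lemma ex_AB_composition_into_pseudo_interior:
  assumes "p \<in> Q" "q \<in> pseudo_interior"
  shows "\<exists>h. AB_composition h \<and> homeomorphic_map hilbert_cube hilbert_cube h \<and> h p = q"
proof (cases "p \<in> pseudo_interior")
  case True
  then show ?thesis
    using ex_type_A_pseudo_interior[OF _ assms(2)] AB_composition.intros(1) by blast
next
  case False
  then have "p \<in> pseudo_boundary" using assms(1) by (simp add: pseudo_boundary_def)
  then obtain f where f: "type_B f" "f p \<in> pseudo_interior"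
    using ex_type_B_into_pseudo_interior by blast
  obtain g where g: "type_A g" "homeomorphic_map hilbert_cube hilbert_cube g" "g (f p) = q"
    using ex_type_A_pseudo_interior[OF f(2) assms(2)] by blast
  have "AB_composition (g \<circ> f)" using f g by (blast intro: AB_composition.intros)
  moreover have "homeomorphic_map hilbert_cube hilbert_cube (g \<circ> f)"
    using f(1) g(2) homeomorphic_map_compose type_B_def by blast
  ultimately show ?thesis using g(3) by auto
qed

lemma AB_composition_imp_AB_inv: "AB_composition h \<Longrightarrow> AB_inv_composition h"
  by (induction rule: AB_composition.induct) (blast intro: AB_inv_composition.intros)+

text \<open>For \<open>q\<close> on the pseudo-boundary, a type (B) map \<open>f\<close> moves
  \<open>q\<close> into the pseudo-interior, \<open>p\<close> is steered to \<open>f q\<close>, and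
  the inverse of \<open>f\<close> leads back to \<open>q\<close>.\<close>

lemma ex_AB_inv_composition:
  assumes "p \<in> Q" "q \<in> Q"
  shows "\<exists>h. AB_inv_composition h \<and> homeomorphic_map hilbert_cube hilbert_cube h \<and> h p = q"
proof (cases "q \<in> pseudo_interior")
  case True
  then show ?thesis
    using ex_AB_composition_into_pseudo_interior[OF assms(1)] AB_composition_imp_AB_inv by blast
next
  case False
  then have "q \<in> pseudo_boundary" using assms(2) by (simp add: pseudo_boundary_def)
  then obtain f where f: "type_B f" "f q \<in> pseudo_interior"
    using ex_type_B_into_pseudo_interior by blast
  then obtain g where fg: "homeomorphic_maps hilbert_cube hilbert_cube f g"
    by (auto simp: type_B_def homeomorphic_map_maps)
  obtain h where h: "AB_composition h" "homeomorphic_map hilbert_cube hilbert_cube h" "h p = f q"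
    using ex_AB_composition_into_pseudo_interior[OF assms(1) f(2)] by blast
  have "AB_inv_composition (g \<circ> h)"
    using AB_composition_imp_AB_inv[OF h(1)] AB_inv_composition.intros(3)[OF f(1) fg]
    by (rule AB_inv_composition.intros(4))
  moreover have "homeomorphic_map hilbert_cube hilbert_cube (g \<circ> h)"
    using h(2) fg homeomorphic_map_compose homeomorphic_maps_map by blast
  moreover have "(g \<circ> h) p = q" using fg assms(2) h(3) by (simp add: homeomorphic_maps_def)
  ultimately show ?thesis by blast
qed

theorem theorem5p2:
  "homogeneous_space hilbert_cube \<and>
   (\<forall>p\<in>Q. \<forall>q\<in>Q. \<exists>h. AB_inv_composition h \<and>
      homeomorphic_map hilbert_cube hilbert_cube h \<and> h p = q) \<and>
   (\<forall>p\<in>Q. \<forall>q\<in>pseudo_interior. \<exists>h. AB_composition h \<and>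
      homeomorphic_map hilbert_cube hilbert_cube h \<and> h p = q)"
  unfolding homogeneous_space_def
proof (intro conjI ballI)
  fix p q assume "p \<in> Q" "q \<in> Q"
  then show "\<exists>h. AB_inv_composition h \<and>
      homeomorphic_map hilbert_cube hilbert_cube h \<and> h p = q"
    by (rule ex_AB_inv_composition)
  then show "\<exists>h. homeomorphic_map hilbert_cube hilbert_cube h \<and> h p = q" by blast
qed (rule ex_AB_composition_into_pseudo_interior)

end
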